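(* Let $X$ be a real normed space such that every point of $S_X$ is a denting point of $B_X$. Let $K\subset X$ be a closed cone and let $A\subset X\setminus\{0_X\}$ be directionally compact with $A\cap K=\varnothing$. Then there exist $m\in\mathbb N$, $g_1,\ldots,g_m\in S_{X^*}$ and $\alpha_1,\ldots,\alpha_m\in(0,1)$ such that, setting $C_i:=\{x\in X:g_i(x)\ge\alpha_i\|x\|\}$ and $D:=\bigcup_{i=1}^mC_i$, one has \[ A\subset\bigcup_{i=1}^m\operatorname{int}C_i\subset\operatorname{int}D\qquad\text{and}\qquad D\cap K=\{0_X\}. \] Moreover, the function \[ \Phi_{\mathrm{BP}}(x):=\frac12\max_{1\le i\le m}\bigl(g_i(x)-\alpha_i\|x\|\bigr) \] is continuous and positively homogeneous, satisfies $D=\{\Phi_{\mathrm{BP}}\ge0\}$ and $|\Phi_{\mathrm{BP}}(x)|\le\|x\|$ for every $x\in X$, and there exists $\eta>0$ such that \[ \Phi_{\mathrm{BP}}(a)\ge\eta\|a\|>0\quad\forall a\in A,\qquad \Phi_{\mathrm{BP}}(k)\le0\quad\forall k\in K, \] with $\Phi_{\mathrm{BP}}(k)<0$ for every $k\in K\setminus\{0_X\}$.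
   Context: $S_X$, $B_X$ are the unit sphere and closed unit ball of $X$, $S_{X^*}$ the unit sphere of the dual. A nonempty set $C\subset X$ is a cone if $tC\subset C$ for every $t\ge 0$; all cones are assumed proper, i.e. $\{0_X\}\subsetneq C\subsetneq X$ (not necessarily convex). A point $u\in B_X$ is a denting point of $B_X$ if for every $\varepsilon>0$ there exist $f\in S_{X^*}$ and $\gamma>0$ such that the slice $\{x\in B_X:f(x)>1-\gamma\}$ contains $u$ and has diameter $<\varepsilon$. A set $A\subset X\setminus\{0_X\}$ is directionally compact if $\{a/\|a\|:a\in A\}$ is norm compact. A mapping is positively homogeneous if $\Phi(tx)=t\Phi(x)$ for all $t\ge0$, $x\in X$. *)

theory Defs
  imports "HOL-Analysis.Analysis"
begin

definition proper_cone :: "'a::real_normed_vector set \<Rightarrow> bool" where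
  "proper_cone C \<longleftrightarrow> C \<noteq> {} \<and> cone C \<and> {0} \<subset> C \<and> C \<subset> UNIV"

definition unit_ball_slice :: "('a::real_normed_vector \<Rightarrow>\<^sub>L real) \<Rightarrow> real \<Rightarrow> 'a set" where
  "unit_ball_slice f \<gamma> = {x \<in> cball 0 1. f x > 1 - \<gamma>}"

definition denting_point_unit_ball :: "'a::real_normed_vector \<Rightarrow> bool" where
  "denting_point_unit_ball u \<longleftrightarrow> u \<in> cball 0 1 \<and>
     (\<forall>\<epsilon>>0. \<exists>f \<in> sphere 0 1. \<exists>\<gamma>>0.
        u \<in> unit_ball_slice f \<gamma> \<and> diameter (unit_ball_slice f \<gamma>) < \<epsilon>)"

definition directionally_compact :: "'a::real_normed_vector set \<Rightarrow> bool" where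
  "directionally_compact A \<longleftrightarrow> 0 \<notin> A \<and> compact ((\<lambda>a. a /\<^sub>R norm a) ` A)"

definition positively_homogeneous :: "('a::real_normed_vector \<Rightarrow> real) \<Rightarrow> bool" where
  "positively_homogeneous \<Phi> \<longleftrightarrow> (\<forall>t\<ge>0. \<forall>x. \<Phi> (t *\<^sub>R x) = t * \<Phi> x)"

definition bp_cone :: "('a::real_normed_vector \<Rightarrow>\<^sub>L real) \<Rightarrow> real \<Rightarrow> 'a set" where
  "bp_cone g \<alpha> = {x. g x \<ge> \<alpha> * norm x}"

(* Only meaningful for m \<ge> 1, since Max is unspecified on the empty set. *)
definition Phi_BP ::
    "nat \<Rightarrow> (nat \<Rightarrow> 'a::real_normed_vector \<Rightarrow>\<^sub>L real) \<Rightarrow> (nat \<Rightarrow> real) \<Rightarrow> 'a \<Rightarrow> real" where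
  "Phi_BP m g \<alpha> x = 1 / 2 * (MAX i\<in>{1..m}. g i x - \<alpha> i * norm x)"

end

theory Submission
  imports Defs
begin

text \<open>
  A slice of the ball around a denting point \<open>u \<notin> K\<close> that is small enough to miss \<open>K\<close> spans
  a Bishop--Phelps cone which meets \<open>K\<close> only in the origin and has \<open>u\<close> in its interior.
  By compactness finitely many of these cones cover the directions of \<open>A\<close>, and \<open>\<eta>\<close> is the
  minimum of \<open>\<Phi>\<close> over those directions.
\<close>

text \<open>The slice has diameter below \<open>\<epsilon>\<close> and contains \<open>u\<close>, so
  it stays within \<open>\<epsilon>\<close> of \<open>u\<close>. The origin is at distance 1 from
  \<open>u\<close>, hence outside the slice, and this forces \<open>1 - \<gamma> \<ge> 0\<close>.
  That inequality later makes the cone parameter positive.\<close>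

lemma small_slice_bounds:
  fixes f :: "'a::real_normed_vector \<Rightarrow>\<^sub>L real"
  assumes u: "norm u = 1" and "u \<in> unit_ball_slice f \<gamma>"
    and diam: "diameter (unit_ball_slice f \<gamma>) < \<epsilon>" and "\<epsilon> \<le> 1"
  shows "\<gamma> \<le> 1" and "unit_ball_slice f \<gamma> \<subseteq> ball u \<epsilon>"
proof -
  have bdd: "bounded (unit_ball_slice f \<gamma>)"
    by (rule bounded_subset[OF bounded_cball[of 0 1]]) (auto simp: unit_ball_slice_def)
  show sub: "unit_ball_slice f \<gamma> \<subseteq> ball u \<epsilon>"
    using diameter_bounded_bound[OF bdd assms(2)] diam by fastforce
  have "0 \<notin> unit_ball_slice f \<gamma>"
    using sub u \<open>\<epsilon> \<le> 1\<close> by auto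
  then show "\<gamma> \<le> 1"
    by (simp add: unit_ball_slice_def)
qed

lemma denting_point_bp_cone:
  fixes u :: "'a::real_normed_vector"
  assumes "denting_point_unit_ball u" and u: "norm u = 1"
    and K: "cone K" "closed K" "0 \<in> K" and "u \<notin> K"
  obtains g :: "'a \<Rightarrow>\<^sub>L real" and \<alpha> :: real
  where "norm g = 1" "0 < \<alpha>" "\<alpha> < 1" "\<alpha> < g u" "bp_cone g \<alpha> \<inter> K = {0}"
proof -
  obtain e where "e > 0" and e: "ball u e \<subseteq> - K"
    using K(2) \<open>u \<notin> K\<close> by (metis ComplI open_Compl open_contains_ball)
  \<comment> \<open>The bound \<open>e\<close> keeps the slice off \<open>K\<close>; the bound 1
    keeps it off the origin.\<close>
  define \<epsilon> where "\<epsilon> = min e 1"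
  have "\<epsilon> > 0" "\<epsilon> \<le> 1" "ball u \<epsilon> \<subseteq> - K"
    using \<open>e > 0\<close> e by (auto simp: \<epsilon>_def)
  then obtain f \<gamma> where f: "f \<in> sphere 0 1" "\<gamma> > 0" "u \<in> unit_ball_slice f \<gamma>"
      "diameter (unit_ball_slice f \<gamma>) < \<epsilon>"
    using assms(1) unfolding denting_point_unit_ball_def by blast
  have nf: "norm f = 1"
    using f(1) by simp
  note slice = small_slice_bounds[OF u f(3,4) \<open>\<epsilon> \<le> 1\<close>]
  \<comment> \<open>The midpoint lies strictly above \<open>1 - \<gamma>\<close>, so that normalised
    vectors of the cone fall into the slice, and strictly below \<open>f u\<close>, so that
    \<open>u\<close> is interior to the cone. It is positive since \<open>\<gamma> \<le> 1\<close>,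
    and below 1 since \<open>f u \<le> 1\<close> and \<open>\<gamma> > 0\<close>.\<close>
  define \<alpha> where "\<alpha> = (1 - \<gamma> + f u) / 2"
  have fu: "f u > 1 - \<gamma>" "f u \<le> 1"
    using f(3) norm_blinfun[of f u] nf u by (auto simp: unit_ball_slice_def)
  then have \<alpha>: "0 < \<alpha>" "\<alpha> < 1" "\<alpha> < f u" "1 - \<gamma> < \<alpha>"
    using slice(1) f(2) by (auto simp: \<alpha>_def)
  have "x = 0" if "x \<in> bp_cone f \<alpha>" "x \<in> K" for x
  proof (rule ccontr)
    assume "x \<noteq> 0"
    then have "f (x /\<^sub>R norm x) \<ge> \<alpha>"
      using that(1) by (simp add: bp_cone_def blinfun.scaleR_right field_simps)
    then have "x /\<^sub>R norm x \<in> unit_ball_slice f \<gamma>"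
      using \<alpha>(4) \<open>x \<noteq> 0\<close> by (simp add: unit_ball_slice_def)
    then have "x /\<^sub>R norm x \<notin> K"
      using slice(2) \<open>ball u \<epsilon> \<subseteq> - K\<close> by blast
    then show False
      using K(1) that(2) by (simp add: cone_def)
  qed
  moreover have "0 \<in> bp_cone f \<alpha>"
    by (simp add: bp_cone_def blinfun.zero_right)
  ultimately have "bp_cone f \<alpha> \<inter> K = {0}"
    using K(3) by blast
  with nf \<alpha>(1-3) show thesis
    by (rule that)
qed

lemma Phi_BP_ge_0_iff:
  assumes "m \<ge> 1"
  shows "Phi_BP m g \<alpha> x \<ge> 0 \<longleftrightarrow> (\<exists>i\<in>{1..m}. x \<in> bp_cone (g i) (\<alpha> i))"
  using assms by (simp add: Phi_BP_def Max_ge_iff bp_cone_def)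

text \<open>Unlike membership in a cone, the strict inequality is an open condition, so positive
  values of \<open>Phi_BP\<close> certify interior points.\<close>

lemma Phi_BP_gt_0_iff:
  assumes "m \<ge> 1"
  shows "Phi_BP m g \<alpha> x > 0 \<longleftrightarrow> (\<exists>i\<in>{1..m}. g i x > \<alpha> i * norm x)"
  using assms by (simp add: Phi_BP_def Max_gr_iff)

lemma Phi_BP_attained:
  assumes "m \<ge> 1"
  obtains i where "i \<in> {1..m}" "Phi_BP m g \<alpha> x = (g i x - \<alpha> i * norm x) / 2"
proof -
  have "(MAX i\<in>{1..m}. g i x - \<alpha> i * norm x) \<in> (\<lambda>i. g i x - \<alpha> i * norm x) ` {1..m}"
    by (rule Max_in) (use assms in auto)
  then show thesis
    using that by (auto simp: Phi_BP_def)
qed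

text \<open>Induction on the index set reduces this to the binary \<open>max\<close>; it starts from
  singletons because \<open>Max\<close> is unspecified on the empty set.\<close>

lemma continuous_on_Max_image:
  fixes f :: "'i \<Rightarrow> 'a::topological_space \<Rightarrow> 'b::linorder_topology"
  assumes "finite I" "I \<noteq> {}" "\<And>i. i \<in> I \<Longrightarrow> continuous_on S (f i)"
  shows "continuous_on S (\<lambda>x. MAX i\<in>I. f i x)"
  using assms
proof (induction I rule: finite_ne_induct)
  case (insert i I)
  have "(MAX j\<in>insert i I. f j x) = max (f i x) (MAX j\<in>I. f j x)" for x
    using insert.hyps by simp
  then show ?case
    using insert by (simp add: continuous_on_max)
qed simp

lemma continuous_on_Phi_BP:
  assumes "m \<ge> 1"
  shows "continuous_on S (Phi_BP m g \<alpha>)"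
  unfolding Phi_BP_def[abs_def]
  by (intro continuous_intros continuous_on_Max_image) (use assms in auto)

lemma positively_homogeneous_Phi_BP:
  assumes "m \<ge> 1"
  shows "positively_homogeneous (Phi_BP m g \<alpha>)"
  unfolding positively_homogeneous_def
proof (intro allI impI)
  fix t :: real and x
  assume "t \<ge> 0"
  let ?h = "\<lambda>i. g i x - \<alpha> i * norm x"
  \<comment> \<open>A monotone map commutes with \<open>Max\<close>; this treats
    \<open>t = 0\<close> and \<open>t > 0\<close> alike.\<close>
  have "mono ((*) t)"
    using \<open>t \<ge> 0\<close> by (simp add: mono_def mult_left_mono)
  then have "t * Max (?h ` {1..m}) = Max ((*) t ` ?h ` {1..m})"
    by (rule mono_Max_commute) (use assms in auto)
  also have "(*) t ` ?h ` {1..m} = (\<lambda>i. g i (t *\<^sub>R x) - \<alpha> i * norm (t *\<^sub>R x)) ` {1..m}"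
    unfolding image_image using \<open>t \<ge> 0\<close>
    by (intro image_cong) (auto simp: blinfun.scaleR_right algebra_simps)
  finally show "Phi_BP m g \<alpha> (t *\<^sub>R x) = t * Phi_BP m g \<alpha> x"
    by (simp add: Phi_BP_def)
qed

text \<open>At an index attaining the maximum both terms of the difference are at most
  \<open>norm x\<close> in absolute value; the factor 1/2 in \<open>Phi_BP\<close> absorbs the
  resulting 2.\<close>

lemma abs_Phi_BP_le:
  assumes "m \<ge> 1" and *: "\<And>i. i \<in> {1..m} \<Longrightarrow> norm (g i) = 1 \<and> 0 < \<alpha> i \<and> \<alpha> i < 1"
  shows "\<bar>Phi_BP m g \<alpha> x\<bar> \<le> norm x"
proof -
  obtain i where i: "i \<in> {1..m}" "Phi_BP m g \<alpha> x = (g i x - \<alpha> i * norm x) / 2"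
    using assms(1) by (rule Phi_BP_attained)
  have "\<bar>g i x\<bar> \<le> norm x"
    using norm_blinfun[of "g i" x] * i(1) by simp
  moreover have "0 \<le> \<alpha> i * norm x" "\<alpha> i * norm x \<le> norm x"
    using *[OF i(1)] by (auto intro: mult_left_le_one_le)
  ultimately have "\<bar>g i x - \<alpha> i * norm x\<bar> \<le> 2 * norm x"
    by linarith
  then show ?thesis
    unfolding i(2) by simp
qed

theorem corollary4p3:
  fixes K A :: "'a::real_normed_vector set"
  assumes "\<And>u::'a. u \<in> sphere 0 1 \<Longrightarrow> denting_point_unit_ball u"
    and "proper_cone K" and "closed K"
    and "directionally_compact A"
    and "A \<inter> K = {}"
  shows "\<exists>(m::nat) (g :: nat \<Rightarrow> 'a \<Rightarrow>\<^sub>L real) (\<alpha> :: nat \<Rightarrow> real) (D :: 'a set).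
     m \<ge> 1 \<and>
     (\<forall>i\<in>{1..m}. g i \<in> sphere 0 1 \<and> \<alpha> i \<in> {0<..<1}) \<and>
     D = (\<Union>i\<in>{1..m}. bp_cone (g i) (\<alpha> i)) \<and>
     A \<subseteq> (\<Union>i\<in>{1..m}. interior (bp_cone (g i) (\<alpha> i))) \<and>
     (\<Union>i\<in>{1..m}. interior (bp_cone (g i) (\<alpha> i))) \<subseteq> interior D \<and>
     D \<inter> K = {0} \<and>
     continuous_on UNIV (Phi_BP m g \<alpha>) \<and>
     positively_homogeneous (Phi_BP m g \<alpha>) \<and>
     D = {x. Phi_BP m g \<alpha> x \<ge> 0} \<and>
     (\<forall>x. \<bar>Phi_BP m g \<alpha> x\<bar> \<le> norm x) \<and>
     (\<exists>\<eta>>0. \<forall>a\<in>A. Phi_BP m g \<alpha> a \<ge> \<eta> * norm a \<and> \<eta> * norm a > 0) \<and>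
     (\<forall>k\<in>K. Phi_BP m g \<alpha> k \<le> 0) \<and>
     (\<forall>k\<in>K - {0}. Phi_BP m g \<alpha> k < 0)"
proof -
  have "cone K" "0 \<in> K" and "K \<noteq> UNIV"
    using assms(2) by (auto simp: proper_cone_def)
  have "0 \<notin> A" and compact_dirs: "compact ((\<lambda>a. a /\<^sub>R norm a) ` A)"
    using assms(4) by (auto simp: directionally_compact_def)
  obtain z where "z \<notin> K"
    using \<open>K \<noteq> UNIV\<close> by blast
  \<comment> \<open>Adding a direction outside \<open>K\<close> ensures \<open>m \<ge> 1\<close> when \<open>A\<close> is empty.\<close>
  define S where "S = (\<lambda>a. a /\<^sub>R norm a) ` insert z A"
  have "compact S" "S \<noteq> {}"
    using compact_dirs by (auto simp: S_def)
  have S: "norm s = 1 \<and> s \<notin> K" if "s \<in> S" for s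
  proof -
    obtain a where a: "s = a /\<^sub>R norm a" "a \<notin> K"
      using \<open>s \<in> S\<close> \<open>z \<notin> K\<close> assms(5) unfolding S_def by blast
    then have "a \<noteq> 0"
      using \<open>0 \<in> K\<close> by blast
    \<comment> \<open>Scaling back: if \<open>s\<close> were in the cone \<open>K\<close>, so would
      be \<open>a\<close>.\<close>
    then have "a = norm a *\<^sub>R s"
      using a(1) by simp
    then have "s \<notin> K"
      using a(2) \<open>cone K\<close> by (metis cone_def norm_ge_zero)
    then show ?thesis
      using a(1) \<open>a \<noteq> 0\<close> by simp
  qed
  have "\<exists>(g :: 'a \<Rightarrow>\<^sub>L real) \<alpha>. norm g = 1 \<and> 0 < \<alpha> \<and> \<alpha> < 1 \<and> \<alpha> < blinfun_apply g s \<and>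
      bp_cone g \<alpha> \<inter> K = {0}"
    if "s \<in> S" for s
  proof -
    have "denting_point_unit_ball s"
      using S[OF that] assms(1) by simp
    then show ?thesis
      using S[OF that] \<open>cone K\<close> assms(3) \<open>0 \<in> K\<close> by (metis denting_point_bp_cone)
  qed
  then obtain G :: "'a \<Rightarrow> 'a \<Rightarrow>\<^sub>L real" and \<beta> :: "'a \<Rightarrow> real" where
    G\<beta>: "\<And>s. s \<in> S \<Longrightarrow> norm (G s) = 1 \<and> 0 < \<beta> s \<and> \<beta> s < 1 \<and> \<beta> s < G s s \<and>
      bp_cone (G s) (\<beta> s) \<inter> K = {0}"
    by metis
  \<comment> \<open>An open part of the cone of \<open>s\<close> that contains \<open>s\<close>
    itself, because \<open>norm s = 1\<close> and \<open>\<beta> s < G s s\<close>. These sets give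
    the cover of \<open>S\<close> and later witness interior points.\<close>
  define U where "U s = {x. G s x > \<beta> s * norm x}" for s
  have "open (U s)" for s
    unfolding U_def by (intro open_Collect_less continuous_intros)
  moreover have "S \<subseteq> (\<Union>s\<in>S. U s)"
    using G\<beta> S by (auto simp: U_def)
  ultimately obtain T where T: "T \<subseteq> S" "finite T" "S \<subseteq> (\<Union>s\<in>T. U s)"
    using \<open>compact S\<close> by (metis compactE_image)
  define m where "m = card T"
  obtain t where t: "bij_betw t {1..m} T"
    using ex_bij_betw_nat_finite_1[OF T(2)] m_def by blast
  then have tT: "t ` {1..m} = T"
    by (simp add: bij_betw_def)
  \<comment> \<open>For \<open>m = 0\<close> the set \<open>T\<close> would be empty and could not
    cover the nonempty \<open>S\<close>.\<close>
  have "m \<ge> 1"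
    using tT T(3) \<open>S \<noteq> {}\<close> by (cases m) auto
  define g where "g i = G (t i)" for i
  define \<alpha> where "\<alpha> i = \<beta> (t i)" for i
  define D where "D = (\<Union>i\<in>{1..m}. bp_cone (g i) (\<alpha> i))"
  let ?\<Phi> = "Phi_BP m g \<alpha>"
  have g\<alpha>: "norm (g i) = 1 \<and> 0 < \<alpha> i \<and> \<alpha> i < 1" "bp_cone (g i) (\<alpha> i) \<inter> K = {0}"
    if "i \<in> {1..m}" for i
  proof -
    have "t i \<in> S"
      using tT T(1) that by blast
    then show "norm (g i) = 1 \<and> 0 < \<alpha> i \<and> \<alpha> i < 1" "bp_cone (g i) (\<alpha> i) \<inter> K = {0}"
      using G\<beta> by (simp_all add: g_def \<alpha>_def)
  qed
  \<comment> \<open>Each cone meets \<open>K\<close> exactly in the origin; \<open>m \<ge> 1\<close>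
    ensures that at least one cone contributes it.\<close>
  have DK: "D \<inter> K = {0}"
    using g\<alpha>(2) \<open>m \<ge> 1\<close> by (force simp: D_def)
  have D: "D = {x. ?\<Phi> x \<ge> 0}"
    using Phi_BP_ge_0_iff[OF \<open>m \<ge> 1\<close>] by (auto simp: D_def)
  have hom: "?\<Phi> (c *\<^sub>R x) = c * ?\<Phi> x" if "c \<ge> 0" for c x
    using positively_homogeneous_Phi_BP[OF \<open>m \<ge> 1\<close>, of g \<alpha>] that
    by (simp add: positively_homogeneous_def)
  have "?\<Phi> s > 0" if "s \<in> S" for s
    using T(3) that tT unfolding Phi_BP_gt_0_iff[OF \<open>m \<ge> 1\<close>] by (force simp: U_def g_def \<alpha>_def)
  moreover obtain s0 where "s0 \<in> S" and s0: "\<And>s. s \<in> S \<Longrightarrow> ?\<Phi> s0 \<le> ?\<Phi> s"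
    using continuous_attains_inf[OF \<open>compact S\<close> \<open>S \<noteq> {}\<close> continuous_on_Phi_BP[OF \<open>m \<ge> 1\<close>]]
    by blast
  ultimately have "?\<Phi> s0 > 0"
    by blast
  have A_pos: "?\<Phi> a \<ge> ?\<Phi> s0 * norm a \<and> ?\<Phi> s0 * norm a > 0" if "a \<in> A" for a
  proof -
    have "a \<noteq> 0"
      using that \<open>0 \<notin> A\<close> by blast
    have "a /\<^sub>R norm a \<in> S"
      using that by (simp add: S_def)
    \<comment> \<open>Homogeneity carries the minimum over directions to \<open>A\<close>, with
      \<open>?\<Phi> s0\<close> as \<open>\<eta>\<close>.\<close>
    then have "norm a * ?\<Phi> s0 \<le> norm a * ?\<Phi> (a /\<^sub>R norm a)"
      by (intro mult_left_mono s0) auto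
    also have "\<dots> = ?\<Phi> a"
      using hom[of "norm a" "a /\<^sub>R norm a"] \<open>a \<noteq> 0\<close> by simp
    finally show ?thesis
      using \<open>?\<Phi> s0 > 0\<close> \<open>a \<noteq> 0\<close> by (simp add: mult.commute)
  qed
  have A_int: "A \<subseteq> (\<Union>i\<in>{1..m}. interior (bp_cone (g i) (\<alpha> i)))"
  proof
    fix a assume "a \<in> A"
    then have "?\<Phi> a > 0"
      using A_pos by fastforce
    then obtain i where i: "i \<in> {1..m}" "g i a > \<alpha> i * norm a"
      using Phi_BP_gt_0_iff[OF \<open>m \<ge> 1\<close>] by blast
    have "U (t i) \<subseteq> interior (bp_cone (g i) (\<alpha> i))"
      using \<open>open (U (t i))\<close>
      by (intro interior_maximal) (auto simp: U_def bp_cone_def g_def \<alpha>_def)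
    moreover have "a \<in> U (t i)"
      using i(2) by (simp add: U_def g_def \<alpha>_def)
    ultimately show "a \<in> (\<Union>i\<in>{1..m}. interior (bp_cone (g i) (\<alpha> i)))"
      using i(1) by blast
  qed
  have int_D: "(\<Union>i\<in>{1..m}. interior (bp_cone (g i) (\<alpha> i))) \<subseteq> interior D"
    unfolding D_def by (intro UN_least interior_mono UN_upper)
  \<comment> \<open>Such a \<open>k\<close> lies outside \<open>D\<close>, which is the set where
    \<open>?\<Phi>\<close> is nonnegative.\<close>
  have K_neg: "?\<Phi> k < 0" if "k \<in> K - {0}" for k
    using that D DK by force
  \<comment> \<open>At the origin, homogeneity with factor 0 gives the value 0.\<close>
  have K_nonpos: "?\<Phi> k \<le> 0" if "k \<in> K" for k
    using that K_neg[of k] hom[of 0 0] by (cases "k = 0") auto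
  have norms: "\<forall>i\<in>{1..m}. g i \<in> sphere 0 1 \<and> \<alpha> i \<in> {0<..<1}"
    using g\<alpha>(1) by simp
  have bound: "\<forall>x. \<bar>?\<Phi> x\<bar> \<le> norm x"
    using abs_Phi_BP_le[OF \<open>m \<ge> 1\<close>] g\<alpha>(1) by blast
  have eta: "\<exists>\<eta>>0. \<forall>a\<in>A. ?\<Phi> a \<ge> \<eta> * norm a \<and> \<eta> * norm a > 0"
    using A_pos \<open>?\<Phi> s0 > 0\<close> by blast
  show ?thesis
    by (rule exI[of _ m], rule exI[of _ g], rule exI[of _ \<alpha>], rule exI[of _ D])
      (intro conjI \<open>m \<ge> 1\<close> norms D_def A_int int_D DK D bound eta ballI K_neg K_nonpos
        continuous_on_Phi_BP[OF \<open>m \<ge> 1\<close>] positively_homogeneous_Phi_BP[OF \<open>m \<ge> 1\<close>])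
qed

end
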